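(* Let $k\ge 1$, $m\ge 0$ and $n\ge 1$ be integers. Let $c_{k,n,o}^{(m)}$ (respectively $c_{k,n,e}^{(m)}$) be the number of odd (respectively even) compositions of $n+k-1$ with exactly $m$ parts less than $k$, each of which is (immediately) preceded by a part at least $k$ and (immediately) followed by either the last part of the composition or a part greater than $k$. Let $b_{k,n}^{(m)}:=c_{k,n,o}^{(m)}-c_{k,n,e}^{(m)}$. Then \begin{align*} b_{k,n}^{(m)} &= \sum_{\substack{\lambda\subseteq (k-2)^m \\ i+(k+1)m+jk+|\lambda|=n}} (-1)^{j}\binom{i}{m}\binom{i+j-1}{j}\, m_\lambda(1^m) \\ &= \sum_{i+(k+1)m+jk+\ell(k-1)+h=n} (-1)^{\ell+j}\binom{i}{m}\binom{i+j-1}{j}\binom{m}{\ell}\binom{m+h-1}{h}, \end{align*} where the first sum is over all partitions $\lambda\subseteq (k-2)^m$ and nonnegative integers $i,j$ satisfying the displayed condition, and the second sum is over all nonnegative integers $i,j,\ell,h$ satisfying the displayed condition.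
   Context: A composition of a nonnegative integer $N$ is a finite sequence $\alpha=(\alpha_1,\ldots,\alpha_\ell)$ of positive integers with $\alpha_1+\cdots+\alpha_\ell=N$; the $\alpha_i$ are its parts and $\ell$ is its length. A composition is called even (respectively odd) if its length is even (respectively odd). A part $\alpha_p<k$ satisfies the required condition if $1<p<\ell$, $\alpha_{p-1}\ge k$, and either $p+1=\ell$ or $\alpha_{p+1}>k$. The notation $\lambda\subseteq r^d$ means that $\lambda$ is a partition with no more than $d$ parts, each at most $r$; equivalently, padding with zeros, $\lambda=(\lambda_1\ge\cdots\ge\lambda_d\ge 0)$ with $\lambda_1\le r$ if $d\ge1$ (so there is no such $\lambda$ if $r<0$ and $d\ge 1$, and only the empty partition if $d=0$). Its size is $|\lambda|=\lambda_1+\cdots+\lambda_d$. The number $m_\lambda(1^d)$ is the monomial symmetric function indexed by $\lambda$ in $d$ variables evaluated at $(1,\ldots,1)$; that is, if $\mu_t$ denotes the number of $\lambda_1,\ldots,\lambda_d$ (zeros included) equal to $t$ for $t=0,1,\ldots,r$, then $m_\lambda(1^d)=\frac{d!}{\mu_0!\,\mu_1!\cdots\mu_r!}$ (equal to $1$ if $d=0$). Binomial coefficients $\binom{a}{b}$ with $a\ge0$ and $b>a$ are $0$, and $\binom{-1}{0}=1$ (so $\binom{i+j-1}{j}$ is the coefficient of $x^j$ in $(1-x)^{-i}$, and similarly for $\binom{m+h-1}{h}$). *)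

theory Defs
  imports
    Complex_Main
    "HOL-Combinatorics.Multiset_Permutations"
    "HOL-Library.Groups_Big_Fun"
begin

definition compositions :: "nat \<Rightarrow> nat list set" where
  "compositions N = {\<alpha>. (\<forall>x\<in>set \<alpha>. 0 < x) \<and> sum_list \<alpha> = N}"

text \<open>
  Lists are indexed from \<open>0\<close>: the last part of \<open>\<alpha>\<close> has index \<open>length \<alpha> - 1\<close>, so
  \<open>p + 1 < length \<alpha>\<close> says that a part follows the one at \<open>p\<close>, and \<open>p + 2 = length \<alpha>\<close> that
  this following part is the last one.
\<close>

definition small_parts :: "nat \<Rightarrow> nat list \<Rightarrow> nat set" where
  "small_parts k \<alpha> = {p. p < length \<alpha> \<and> \<alpha> ! p < k}"

definition required_condition :: "nat \<Rightarrow> nat list \<Rightarrow> nat \<Rightarrow> bool" where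
  "required_condition k \<alpha> p \<longleftrightarrow>
     0 < p \<and> p + 1 < length \<alpha> \<and> k \<le> \<alpha> ! (p - 1) \<and> (p + 2 = length \<alpha> \<or> k < \<alpha> ! (p + 1))"

definition admissible_compositions :: "nat \<Rightarrow> nat \<Rightarrow> nat \<Rightarrow> nat list set" where
  "admissible_compositions k n m =
     {\<alpha> \<in> compositions (n + k - 1).
        card (small_parts k \<alpha>) = m \<and> (\<forall>p\<in>small_parts k \<alpha>. required_condition k \<alpha> p)}"

definition c_odd :: "nat \<Rightarrow> nat \<Rightarrow> nat \<Rightarrow> nat" where
  "c_odd k n m = card {\<alpha> \<in> admissible_compositions k n m. odd (length \<alpha>)}"

definition c_even :: "nat \<Rightarrow> nat \<Rightarrow> nat \<Rightarrow> nat" where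
  "c_even k n m = card {\<alpha> \<in> admissible_compositions k n m. even (length \<alpha>)}"

definition b_diff :: "nat \<Rightarrow> nat \<Rightarrow> nat \<Rightarrow> int" where
  "b_diff k n m = int (c_odd k n m) - int (c_even k n m)"

text \<open>
  Partitions \<open>\<lambda> \<subseteq> r\<^sup>d\<close>, padded with zeros to length exactly \<open>d\<close>.  The bound \<open>r\<close> is an integer,
  since \<open>r = k - 2\<close> is \<open>-1\<close> for \<open>k = 1\<close>; then there is no such \<open>\<lambda>\<close> unless \<open>d = 0\<close>.
\<close>

definition box_partitions :: "int \<Rightarrow> nat \<Rightarrow> nat list set" where
  "box_partitions r d = {lam. length lam = d \<and> sorted_wrt (\<ge>) lam \<and> (\<forall>x\<in>set lam. int x \<le> r)}"

text \<open>
  The monomial symmetric function \<open>m\<^sub>\<lambda>(x\<^sub>0, \<dots>, x\<^bsub>d-1\<^esub>)\<close> for \<open>\<lambda>\<close> padded to length \<open>d\<close>: the sum of the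
  monomials \<open>x\<^sup>\<beta>\<close> over the distinct rearrangements \<open>\<beta>\<close> of \<open>\<lambda>\<close>.
\<close>

definition monomial_sym :: "nat list \<Rightarrow> (nat \<Rightarrow> 'a::comm_semiring_1) \<Rightarrow> 'a" where
  "monomial_sym lam x =
     (\<Sum>\<beta>\<in>permutations_of_multiset (mset lam). \<Prod>p<length lam. x p ^ (\<beta> ! p))"

definition monomial_sym_ones :: "nat list \<Rightarrow> nat" where
  "monomial_sym_ones lam = monomial_sym lam (\<lambda>_. 1)"

lemma monomial_sym_ones_eq:
  assumes "lam \<in> box_partitions (int r) d"
  shows "monomial_sym_ones lam * (\<Prod>t\<le>r. fact (count_list lam t)) = fact d"
proof -
  have sub: "set lam \<subseteq> {..r}" and len: "length lam = d"
    using assms by (auto simp: box_partitions_def)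
  have "(\<Prod>t\<le>r. fact (count_list lam t)) = (\<Prod>t\<in>set lam. fact (count_list lam t) :: nat)"
    by (rule prod.mono_neutral_right) (use sub in \<open>auto simp: count_list_0_iff\<close>)
  then show ?thesis
    using card_permutations_of_multiset_aux[of "mset lam"] len
    by (simp add: monomial_sym_ones_def monomial_sym_def count_mset)
qed

text \<open>
  Binomial coefficients whose upper entry may be \<open>-1\<close>: \<open>gchoose\<close> at type \<open>int\<close>, written out because
  the sort constraint that the library puts on \<open>gchoose\<close> makes the parser coerce integer
  arguments to \<open>real\<close>.
\<close>

definition int_choose :: "int \<Rightarrow> nat \<Rightarrow> int" where
  "int_choose a c = (\<Prod>i=0..<c. a - int i) div fact c"

lemma int_choose_of_nat: "int_choose (int a) c = int (a choose c)"
  by (simp only: int_choose_def int_binomial gbinomial_prod_rev)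

lemma int_choose_minus_one_0: "int_choose (- 1) 0 = 1"
  by (simp add: int_choose_def)

text \<open>
  The remaining lemmas show that no \<open>card\<close> or sum in the theorem is over an infinite set.  For
  \<open>k = 1\<close> the index \<open>\<ell>\<close> of the second sum is not bounded by the displayed condition, and only the
  factor \<open>m choose \<ell>\<close> makes all but finitely many terms vanish; that sum is therefore expressed
  as \<open>Sum_any\<close>, the sum over all index tuples of a finitely supported function.
\<close>

lemma finite_compositions: "finite (compositions N)"
proof (rule finite_subset)
  have "length xs \<le> sum_list xs" if "\<forall>x\<in>set xs. 0 < x" for xs :: "nat list"
    using that by (induction xs) auto
  then show "compositions N \<subseteq> {xs. set xs \<subseteq> {..N} \<and> length xs \<le> N}"
    by (auto simp: compositions_def dest: member_le_sum_list)
  show "finite {xs. set xs \<subseteq> {..N} \<and> length xs \<le> N}"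
    by (rule finite_lists_length_le) simp
qed

lemma finite_box_partitions: "finite (box_partitions r d)"
proof (rule finite_subset)
  show "box_partitions r d \<subseteq> {xs. set xs \<subseteq> {..nat r} \<and> length xs = d}"
    by (auto simp: box_partitions_def)
  show "finite {xs. set xs \<subseteq> {..nat r} \<and> length xs = d}"
    by (rule finite_lists_length_eq) simp
qed

lemma finite_first_index_set:
  assumes "1 \<le> k"
  shows "finite {(lam, i, j). lam \<in> box_partitions (int k - 2) m \<and>
                   i + (k + 1) * m + j * k + sum_list lam = n}"
proof (rule finite_subset)
  have "j \<le> j * k" for j using assms by simp
  then have "j \<le> n" if "i + (k + 1) * m + j * k + s = n" for i j s
    using that by (metis le_add1 le_add2 le_trans)
  then show "{(lam, i, j). lam \<in> box_partitions (int k - 2) m \<and>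
                i + (k + 1) * m + j * k + sum_list lam = n}
             \<subseteq> box_partitions (int k - 2) m \<times> {..n} \<times> {..n}"
    by auto
qed (simp add: finite_box_partitions)

lemma finite_second_support:
  fixes f :: "nat \<Rightarrow> nat \<Rightarrow> nat \<Rightarrow> nat \<Rightarrow> int"
  assumes "1 \<le> k" and f: "\<And>i j l h. m < l \<Longrightarrow> f i j l h = 0"
  shows "finite {(i, j, l, h).
           (if i + (k + 1) * m + j * k + l * (k - 1) + h = n then f i j l h else 0) \<noteq> 0}"
proof (rule finite_subset)
  have "j \<le> j * k" for j using assms by simp
  then have "j \<le> n" if "i + (k + 1) * m + j * k + s + h = n" for i j s h
    using that by (metis le_add1 le_add2 le_trans)
  moreover have "l \<le> m" if "f i j l h \<noteq> 0" for i j l h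
    using f that not_le by blast
  ultimately show "{(i, j, l, h).
      (if i + (k + 1) * m + j * k + l * (k - 1) + h = n then f i j l h else 0) \<noteq> 0}
      \<subseteq> {..n} \<times> {..n} \<times> {..m} \<times> {..n}"
    by (auto split: if_splits)
qed simp

end

theory Submission
  imports Defs "HOL-Computational_Algebra.Formal_Power_Series"
begin

text \<open>
  Give a list the sign \<open>- (- 1)\<^sup>\<ell>\<close> and cut it after its first part: what follows is a sequence of
  blocks, each a part \<open>\<ge> k\<close> or a part \<open>< k\<close> followed by a part \<open>> k\<close>, except that the last
  block may end in \<open>k\<close>.  With \<open>T = x\<^bsup>k+1\<^esup> (1 + x + \<dots> + x\<^bsup>k-2\<^esup>)\<close> and \<open>y\<close> marking small parts, the
  signed generating function is therefore
  \<open>x\<^sup>k (1 + y T) / (1 + x\<^sup>k - x (1 + y T)) = x\<^bsup>k-1\<^esup> (\<Sum>i\<ge>1. (x (1 + y T) / (1 + x\<^sup>k))\<^sup>i)\<close>,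
  whose coefficient at \<open>y\<^sup>m\<close> is \<open>x\<^bsup>k-1\<^esup> T\<^sup>m (\<Sum>i\<ge>1. (i choose m) x\<^sup>i (1 + x\<^sup>k)\<^bsup>-i\<^esup>)\<close>.  Expanding
  \<open>(1 + x + \<dots> + x\<^bsup>k-2\<^esup>)\<^sup>m\<close> directly, or as \<open>(1 - x\<^bsup>k-1\<^esup>)\<^sup>m (1 - x)\<^bsup>-m\<^esup>\<close>, gives the two sums.
  To avoid power series in two variables, the coefficients at \<open>y\<^sup>m\<close> are compared by induction on
  \<open>m\<close> through their linear recurrences, whose factor \<open>1 - x + x\<^sup>k\<close> can be cancelled.
\<close>

unbundle fps_syntax

section \<open>Generating functions of weighted sets\<close>

text \<open>Over an infinite fibre the sum would be 0 by convention; hence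
  \<open>finite_fibres\<close> is assumed wherever sets are combined by products or unions.\<close>

definition weighted_gf :: "'a set \<Rightarrow> ('a \<Rightarrow> nat) \<Rightarrow> ('a \<Rightarrow> 'b::comm_ring_1) \<Rightarrow> 'b fps" where
  "weighted_gf A w c = Abs_fps (\<lambda>n. \<Sum>a\<in>{a \<in> A. w a = n}. c a)"

definition finite_fibres :: "'a set \<Rightarrow> ('a \<Rightarrow> nat) \<Rightarrow> bool" where
  "finite_fibres A w \<longleftrightarrow> (\<forall>n. finite {a \<in> A. w a = n})"

lemma finite_fibresD: "finite_fibres A w \<Longrightarrow> finite {a \<in> A. w a = n}"
  by (simp add: finite_fibres_def)

lemma finite_fibres_subset: "finite_fibres A w \<Longrightarrow> B \<subseteq> A \<Longrightarrow> finite_fibres B w"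
  unfolding finite_fibres_def by (blast intro: finite_subset[where B = "{a \<in> A. w a = _}"])

lemma finite_fibres_finite: "finite A \<Longrightarrow> finite_fibres A w"
  by (simp add: finite_fibres_def)

lemma finite_fibres_mult:
  fixes A :: "nat set"
  assumes "1 \<le> k"
  shows "finite_fibres A (\<lambda>j. j * k)"
  unfolding finite_fibres_def
proof
  fix n
  have "j \<le> j * k" for j using assms by simp
  then have "{j \<in> A. j * k = n} \<subseteq> {..n}" by auto
  then show "finite {j \<in> A. j * k = n}" by (rule finite_subset) simp
qed

lemma finite_fibres_id: "finite_fibres (A :: nat set) (\<lambda>j. j)"
  using finite_fibres_mult[of 1 A] by simp

lemma fibre_Times:
  "{p \<in> A \<times> B. (case p of (a, b) \<Rightarrow> w a + v b) = (n::nat)}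
     = (\<Union>i\<in>{0..n}. {a \<in> A. w a = i} \<times> {b \<in> B. v b = n - i})"
  by auto

lemma finite_fibres_Times:
  assumes "finite_fibres A w" "finite_fibres B v"
  shows "finite_fibres (A \<times> B) (\<lambda>(a, b). w a + v b)"
  unfolding finite_fibres_def fibre_Times
  using assms by (auto intro!: finite_cartesian_product finite_fibresD)

text \<open>Grouping the pairs of weight \<open>n\<close> by the weight \<open>i\<close> of the
  first component gives the Cauchy product.\<close>

lemma weighted_gf_times:
  assumes "finite_fibres A w" "finite_fibres B v"
  shows "weighted_gf A w c * weighted_gf B v d
           = weighted_gf (A \<times> B) (\<lambda>(a, b). w a + v b) (\<lambda>(a, b). c a * d b)"
proof (rule fps_ext)
  fix n
  have fin: "finite {a \<in> A. w a = i}" "finite {b \<in> B. v b = i}" for i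
    using assms by (auto intro: finite_fibresD)
  have "weighted_gf (A \<times> B) (\<lambda>(a, b). w a + v b) (\<lambda>(a, b). c a * d b) $ n
      = (\<Sum>i=0..n. \<Sum>(a, b)\<in>{a \<in> A. w a = i} \<times> {b \<in> B. v b = n - i}. c a * d b)"
    unfolding weighted_gf_def fps_nth_Abs_fps fibre_Times
    by (rule sum.UNION_disjoint) (use fin in auto)
  also have "\<dots> = (weighted_gf A w c * weighted_gf B v d) $ n"
    by (simp add: fps_mult_nth weighted_gf_def sum_product sum.cartesian_product)
  finally show "(weighted_gf A w c * weighted_gf B v d) $ n
    = weighted_gf (A \<times> B) (\<lambda>(a, b). w a + v b) (\<lambda>(a, b). c a * d b) $ n" by simp
qed

lemma weighted_gf_Un:
  assumes "finite_fibres A w" "finite_fibres B w" "A \<inter> B = {}"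
  shows "weighted_gf (A \<union> B) w c = weighted_gf A w c + weighted_gf B w c"
proof (rule fps_ext)
  fix n
  have "{a \<in> A \<union> B. w a = n} = {a \<in> A. w a = n} \<union> {a \<in> B. w a = n}" by auto
  then show "weighted_gf (A \<union> B) w c $ n = (weighted_gf A w c + weighted_gf B w c) $ n"
    using assms finite_fibresD[OF assms(1), of n] finite_fibresD[OF assms(2), of n]
    by (auto simp: weighted_gf_def intro!: sum.union_disjoint)
qed

lemma weighted_gf_image:
  assumes "inj_on f A"
  shows "weighted_gf (f ` A) w c = weighted_gf A (\<lambda>a. w (f a)) (\<lambda>a. c (f a))"
proof (rule fps_ext)
  fix n
  have "{b \<in> f ` A. w b = n} = f ` {a \<in> A. w (f a) = n}" by auto
  moreover have "inj_on f {a \<in> A. w (f a) = n}"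
    using assms by (rule inj_on_subset) auto
  ultimately show "weighted_gf (f ` A) w c $ n
      = weighted_gf A (\<lambda>a. w (f a)) (\<lambda>a. c (f a)) $ n"
    by (simp add: weighted_gf_def sum.reindex)
qed

lemma weighted_gf_cong:
  assumes "\<And>a. a \<in> A \<Longrightarrow> w a = v a" "\<And>a. a \<in> A \<Longrightarrow> c a = d a"
  shows "weighted_gf A w c = weighted_gf A v d"
proof -
  have "{a \<in> A. w a = n} = {a \<in> A. v a = n}" for n using assms by auto
  then show ?thesis using assms by (auto simp: weighted_gf_def intro!: sum.cong)
qed

lemma weighted_gf_add:
  "weighted_gf A w (\<lambda>a. c a + d a) = weighted_gf A w c + weighted_gf A w d"
  by (rule fps_ext) (simp add: weighted_gf_def sum.distrib)

lemma weighted_gf_cmult: "weighted_gf A w (\<lambda>a. r * c a) = fps_const r * weighted_gf A w c"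
  by (rule fps_ext) (simp add: weighted_gf_def sum_distrib_left)

lemma weighted_gf_uminus: "weighted_gf A w (\<lambda>a. - c a) = - weighted_gf A w c"
  by (rule fps_ext) (simp add: weighted_gf_def sum_negf)

lemma weighted_gf_0: "(\<And>a. a \<in> A \<Longrightarrow> c a = 0) \<Longrightarrow> weighted_gf A w c = 0"
  by (rule fps_ext) (simp add: weighted_gf_def)

lemma weighted_gf_shift:
  "weighted_gf A (\<lambda>a. w a + s) c = fps_X ^ s * weighted_gf A w c"
proof (rule fps_ext)
  fix n
  have "{a \<in> A. w a + s = n} = (if n < s then {} else {a \<in> A. w a = n - s})" by auto
  then show "weighted_gf A (\<lambda>a. w a + s) c $ n = (fps_X ^ s * weighted_gf A w c) $ n"
    by (simp add: weighted_gf_def fps_X_power_mult_nth)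
qed

lemma weighted_gf_finite:
  assumes "finite A"
  shows "weighted_gf A w c = (\<Sum>a\<in>A. fps_const (c a) * fps_X ^ w a)"
proof (rule fps_ext)
  fix n
  have "(\<Sum>a\<in>A. fps_const (c a) * fps_X ^ w a) $ n = (\<Sum>a\<in>A. if w a = n then c a else 0)"
    by (simp add: fps_sum_nth fps_X_power_iff) (auto intro!: sum.cong)
  also have "\<dots> = weighted_gf A w c $ n"
    using assms by (simp add: weighted_gf_def sum.inter_filter)
  finally show "weighted_gf A w c $ n = (\<Sum>a\<in>A. fps_const (c a) * fps_X ^ w a) $ n" by simp
qed

text \<open>The series x^k / (1 - x) of a single part \<ge> \<open>k\<close>, with the denominator
  cleared since the coefficients lie in an arbitrary commutative ring.\<close>

lemma geometric_gf:
  "(1 - fps_X) * weighted_gf {k..} (\<lambda>b. b) (\<lambda>_. 1 :: 'a::comm_ring_1) = fps_X ^ k"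
proof (rule fps_ext)
  have c: "weighted_gf {k..} (\<lambda>b. b) (\<lambda>_. 1 :: 'a) $ n = (if k \<le> n then 1 else 0)" for n
  proof -
    have "{a \<in> {k..}. a = n} = (if k \<le> n then {n} else {})" by auto
    then show ?thesis by (simp add: weighted_gf_def)
  qed
  show "((1 - fps_X) * weighted_gf {k..} (\<lambda>b. b) (\<lambda>_. 1 :: 'a)) $ n = fps_X ^ k $ n" for n
    by (auto simp: left_diff_distrib fps_X_power_iff c)
qed

text \<open>Clears the denominator after a first part is cut off: with \<open>x = 1 - fps_X\<close>,
  \<open>y = fps_X ^ k\<close> and \<open>D\<close> the series of parts \<ge> \<open>k\<close>, the
  equation for \<open>F\<close> acquires the polynomial factor
  \<open>1 - fps_X + fps_X ^ k\<close>.\<close>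

lemma solve_linear:
  fixes x y D F R :: "'a::comm_ring_1"
  assumes "F = R - D * F" "x * D = y"
  shows "(x + y) * F = x * R"
proof -
  have "(x + y) * F = x * (F + D * F)" by (simp add: assms(2)[symmetric] algebra_simps)
  also have "F + D * F = R" by (subst assms(1)) simp
  finally show ?thesis .
qed

section \<open>Decomposition of admissible compositions\<close>

definition well_placed :: "nat \<Rightarrow> nat list \<Rightarrow> bool" where
  "well_placed k \<alpha> \<longleftrightarrow> (\<forall>p\<in>small_parts k \<alpha>. required_condition k \<alpha> p)"

definition admissible :: "nat \<Rightarrow> nat \<Rightarrow> nat list \<Rightarrow> bool" where
  "admissible k m \<alpha> \<longleftrightarrow>
     (\<forall>x\<in>set \<alpha>. 0 < x) \<and> card (small_parts k \<alpha>) = m \<and> well_placed k \<alpha>"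

lemma finite_small_parts: "finite (small_parts k \<alpha>)"
  by (simp add: small_parts_def)

lemma small_parts_Nil: "small_parts k [] = {}"
  by (simp add: small_parts_def)

lemma small_parts_Cons:
  "small_parts k (x # xs) = (if x < k then {0} else {}) \<union> Suc ` small_parts k xs"
proof -
  have "p \<in> small_parts k (x # xs)
      \<longleftrightarrow> p \<in> (if x < k then {0} else {}) \<union> Suc ` small_parts k xs" for p
    by (cases p) (auto simp: small_parts_def)
  then show ?thesis by blast
qed

lemma card_small_parts_Cons:
  "card (small_parts k (x # xs)) = (if x < k then 1 else 0) + card (small_parts k xs)"
  by (auto simp: small_parts_Cons card_insert_if finite_small_parts card_image)

lemma not_required_condition_0: "\<not> required_condition k \<alpha> 0"
  by (simp add: required_condition_def)

text \<open>The condition looks only one place back, so a new head affects positions 0 and 1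
  only.\<close>

lemma required_condition_Suc_Suc:
  "required_condition k (x # xs) (Suc (Suc p)) \<longleftrightarrow> required_condition k xs (Suc p)"
  by (simp add: required_condition_def)

lemma well_placed_single: "well_placed k [b] \<longleftrightarrow> k \<le> b"
  by (simp add: well_placed_def small_parts_Cons small_parts_Nil not_required_condition_0)

text \<open>A small first part would have no predecessor.\<close>

lemma well_placed_hd: "well_placed k (b # \<alpha>) \<Longrightarrow> k \<le> b"
  by (auto simp: well_placed_def small_parts_Cons not_required_condition_0 split: if_splits)

lemma well_placed_big:
  assumes "k \<le> c"
  shows "well_placed k (b # c # \<alpha>) \<longleftrightarrow> k \<le> b \<and> well_placed k (c # \<alpha>)"
  using assms
  by (auto simp: well_placed_def small_parts_Cons not_required_condition_0
      required_condition_Suc_Suc)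

text \<open>The small part at position 1 gives the conditions on \<open>b\<close> and on the start
  of \<open>\<alpha>\<close>. The positions in \<open>\<alpha>\<close> can then be judged in
  \<open>\<alpha>\<close> alone, because a small head of \<open>\<alpha>\<close> is ruled out on
  both sides.\<close>

lemma well_placed_small:
  assumes "s < k"
  shows "well_placed k (b # s # \<alpha>) \<longleftrightarrow>
    k \<le> b \<and> \<alpha> \<noteq> [] \<and> (tl \<alpha> = [] \<or> k < hd \<alpha>) \<and> well_placed k \<alpha>"
proof (cases \<alpha>)
  case Nil
  then show ?thesis
    using assms by (simp add: well_placed_def small_parts_Cons required_condition_def)
next
  case (Cons c \<beta>)
  have req: "required_condition k (b # s # \<alpha>) (Suc 0) \<longleftrightarrow> k \<le> b \<and> (\<beta> = [] \<or> k < c)"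
    by (simp add: Cons required_condition_def)
  have "well_placed k (b # s # \<alpha>) \<longleftrightarrow> k \<le> b \<and> (\<beta> = [] \<or> k < c)
      \<and> (\<forall>p\<in>small_parts k \<alpha>. required_condition k (s # \<alpha>) (Suc p))"
    using assms req
    by (auto simp: well_placed_def small_parts_Cons[of k b] small_parts_Cons[of k s]
        not_required_condition_0 required_condition_Suc_Suc)
  moreover have "(\<forall>p\<in>small_parts k \<alpha>. required_condition k (s # \<alpha>) (Suc p))
      \<longleftrightarrow> well_placed k \<alpha>" if "\<beta> = [] \<or> k < c"
  proof (cases "k \<le> c")
    case True
    then show ?thesis
      by (auto simp: well_placed_def Cons small_parts_Cons[of k c] required_condition_Suc_Suc)
  next
    case False
    with that have "\<beta> = []" by auto
    with False show ?thesis
      by (simp add: Cons well_placed_def small_parts_Cons small_parts_Nil required_condition_def)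
  qed
  ultimately show ?thesis by (auto simp: Cons)
qed

lemma admissible_hd: "admissible k m (c # \<alpha>) \<Longrightarrow> k \<le> c"
  by (auto simp: admissible_def dest: well_placed_hd)

lemma admissible_single: "1 \<le> k \<Longrightarrow> admissible k m [b] \<longleftrightarrow> k \<le> b \<and> m = 0"
  by (auto simp: admissible_def well_placed_single card_small_parts_Cons small_parts_Nil)

lemma admissible_big:
  "1 \<le> k \<Longrightarrow> k \<le> c \<Longrightarrow> admissible k m (b # c # \<alpha>) \<longleftrightarrow> k \<le> b \<and> admissible k m (c # \<alpha>)"
  by (auto simp: admissible_def well_placed_big card_small_parts_Cons)

lemma admissible_small:
  "1 \<le> k \<Longrightarrow> s < k \<Longrightarrow> admissible k m (b # s # \<alpha>)
     \<longleftrightarrow> 0 < s \<and> k \<le> b \<and> \<alpha> \<noteq> [] \<and> (tl \<alpha> = [] \<or> k < hd \<alpha>)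
         \<and> (\<exists>m'. m = Suc m' \<and> admissible k m' \<alpha>)"
  by (auto simp: admissible_def well_placed_small card_small_parts_Cons)

text \<open>The first part follows no other, so beyond being \<ge> \<open>k\<close> its size does
  not matter. This turns heads > \<open>k\<close> into heads \<ge> \<open>k\<close>.\<close>

lemma admissible_Suc_hd:
  assumes "1 \<le> k" "k \<le> c"
  shows "admissible k m (Suc c # \<alpha>) \<longleftrightarrow> admissible k m (c # \<alpha>)"
proof (cases \<alpha>)
  case Nil
  then show ?thesis using assms by (simp add: admissible_single)
next
  case (Cons d \<beta>)
  then show ?thesis
    using assms by (cases "d < k") (auto simp: admissible_small admissible_big)
qed


text \<open>The empty list would count as admissible for \<open>m = 0\<close>; it is left out so
  that every list has a first part to cut off.\<close>

definition admissible_lists :: "nat \<Rightarrow> nat \<Rightarrow> nat list set" where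
  "admissible_lists k m = {\<alpha>. \<alpha> \<noteq> [] \<and> admissible k m \<alpha>}"

text \<open>
  \<open>[k - 1]\<close> is added because raising its head by one gives the final part \<open>k\<close>, the exceptional
  case \<open>p + 1 = \<ell>\<close>; raising the heads of the other lists gives exactly the heads \<open>> k\<close>.
\<close>

definition extended_lists :: "nat \<Rightarrow> nat \<Rightarrow> nat list set" where
  "extended_lists k m = admissible_lists k m \<union> (if m = 0 then {[k - 1]} else {})"

text \<open>The sign is 1 for odd length, so that coefficients count odd minus even lists.\<close>

definition sgn_length :: "nat list \<Rightarrow> int" where
  "sgn_length \<alpha> = - ((- 1) ^ length \<alpha>)"

lemma admissible_lists_0:
  assumes "1 \<le> k"
  shows "admissible_lists k 0
    = (\<lambda>b. [b]) ` {k..} \<union> (\<lambda>(b, \<alpha>). b # \<alpha>) ` ({k..} \<times> admissible_lists k 0)"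
    (is "_ = ?R")
proof (rule equalityI; rule subsetI)
  fix \<alpha> assume a: "\<alpha> \<in> admissible_lists k 0"
  then obtain b \<beta> where \<alpha>: "\<alpha> = b # \<beta>" by (cases \<alpha>) (auto simp: admissible_lists_def)
  show "\<alpha> \<in> ?R"
  proof (cases \<beta>)
    case Nil
    then show ?thesis using a \<alpha> assms by (auto simp: admissible_lists_def admissible_single)
  next
    case (Cons c \<gamma>)
    then show ?thesis
      using a \<alpha> assms
      by (cases "c < k") (auto simp: admissible_lists_def admissible_small admissible_big)
  qed
next
  fix \<alpha> assume a: "\<alpha> \<in> ?R"
  then show "\<alpha> \<in> admissible_lists k 0"
  proof
    assume "\<alpha> \<in> (\<lambda>(b, \<alpha>). b # \<alpha>) ` ({k..} \<times> admissible_lists k 0)"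
    then obtain b \<beta> where "\<alpha> = b # \<beta>" "k \<le> b" "\<beta> \<noteq> []" "admissible k 0 \<beta>"
      by (auto simp: admissible_lists_def)
    then show ?thesis
      using assms admissible_hd[of k 0 "hd \<beta>" "tl \<beta>"] admissible_big[of k "hd \<beta>" 0 b "tl \<beta>"]
      by (simp add: admissible_lists_def)
  qed (use assms in \<open>auto simp: admissible_lists_def admissible_single\<close>)
qed

text \<open>The second part decides. If it is \<ge> \<open>k\<close>, deleting the first part leaves
  an admissible list. If it is \<open>s < k\<close>, deleting both leaves \<open>[k]\<close> or a
  list with head > \<open>k\<close>, and lowering this head by one lands in
  \<open>extended_lists k m\<close>.\<close>

lemma admissible_lists_Suc:
  assumes "1 \<le> k"
  shows "admissible_lists k (Suc m)
    = (\<lambda>(b, \<alpha>). b # \<alpha>) ` ({k..} \<times> admissible_lists k (Suc m))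
      \<union> (\<lambda>(b, s, \<alpha>). b # s # Suc (hd \<alpha>) # tl \<alpha>) ` ({k..} \<times> {1..<k} \<times> extended_lists k m)"
    (is "_ = ?R1 \<union> ?R2")
proof (rule equalityI; rule subsetI)
  fix \<alpha> assume a: "\<alpha> \<in> admissible_lists k (Suc m)"
  then obtain b \<beta> where \<alpha>: "\<alpha> = b # \<beta>" by (cases \<alpha>) (auto simp: admissible_lists_def)
  have "\<beta> \<noteq> []" using a \<alpha> assms by (auto simp: admissible_lists_def admissible_single)
  then obtain s \<gamma> where \<beta>: "\<beta> = s # \<gamma>" by (cases \<beta>) auto
  show "\<alpha> \<in> ?R1 \<union> ?R2"
  proof (cases "s < k")
    case False
    then show ?thesis
      using a \<alpha> \<beta> assms by (auto simp: admissible_lists_def admissible_big)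
  next
    case True
    then have s: "0 < s" "k \<le> b" "\<gamma> \<noteq> []" "tl \<gamma> = [] \<or> k < hd \<gamma>" "admissible k m \<gamma>"
      using a \<alpha> \<beta> assms by (auto simp: admissible_lists_def admissible_small)
    then obtain c \<delta> where \<gamma>: "\<gamma> = c # \<delta>" by (cases \<gamma>) auto
    have "k \<le> c" using s \<gamma> admissible_hd by blast
    \<comment> \<open>The boundary case \<open>c = k\<close> is allowed only for a last part; then
      no small part remains, so \<open>m = 0\<close>, and lowering gives
      \<open>[k - 1]\<close>.\<close>
    have "(c - 1) # \<delta> \<in> extended_lists k m"
    proof (cases "k < c")
      case True
      then show ?thesis
        using s \<gamma> assms admissible_Suc_hd[of k "c - 1" m \<delta>]
        by (simp add: extended_lists_def admissible_lists_def)
    next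
      case False
      with \<open>k \<le> c\<close> have "c = k" by simp
      with s \<gamma> have "\<delta> = []" by auto
      with s \<gamma> \<open>c = k\<close> assms have "m = 0" by (simp add: admissible_single)
      with \<open>\<delta> = []\<close> \<open>c = k\<close> show ?thesis by (simp add: extended_lists_def)
    qed
    moreover have "\<alpha> = (\<lambda>(b, s, \<alpha>). b # s # Suc (hd \<alpha>) # tl \<alpha>) (b, s, (c - 1) # \<delta>)"
      using \<alpha> \<beta> \<gamma> \<open>k \<le> c\<close> assms by simp
    ultimately have "\<alpha> \<in> ?R2"
      using s True by (intro image_eqI[where x = "(b, s, (c - 1) # \<delta>)"]) auto
    then show ?thesis ..
  qed
next
  fix \<alpha> assume "\<alpha> \<in> ?R1 \<union> ?R2"
  then show "\<alpha> \<in> admissible_lists k (Suc m)"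
  proof
    assume "\<alpha> \<in> ?R1"
    then obtain b \<beta> where "\<alpha> = b # \<beta>" "k \<le> b" "\<beta> \<noteq> []" "admissible k (Suc m) \<beta>"
      by (auto simp: admissible_lists_def)
    then show ?thesis
      using assms admissible_hd[of k "Suc m" "hd \<beta>" "tl \<beta>"]
        admissible_big[of k "hd \<beta>" "Suc m" b "tl \<beta>"]
      by (simp add: admissible_lists_def)
  next
    assume "\<alpha> \<in> ?R2"
    then obtain b s \<gamma> where \<alpha>: "\<alpha> = b # s # Suc (hd \<gamma>) # tl \<gamma>" "k \<le> b" "0 < s" "s < k"
      and \<gamma>: "\<gamma> \<in> extended_lists k m"
      by auto
    have "admissible k m (Suc (hd \<gamma>) # tl \<gamma>) \<and> (tl \<gamma> = [] \<or> k < Suc (hd \<gamma>))"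
    proof (cases "\<gamma> \<in> admissible_lists k m")
      case True
      then have "admissible k m (hd \<gamma> # tl \<gamma>)" by (simp add: admissible_lists_def)
      then show ?thesis using assms admissible_hd admissible_Suc_hd by fastforce
    next
      case False
      with \<gamma> have "\<gamma> = [k - 1]" "m = 0" by (auto simp: extended_lists_def split: if_splits)
      then show ?thesis using assms by (simp add: admissible_single)
    qed
    then show ?thesis
      using \<alpha> assms by (simp add: admissible_lists_def admissible_small)
  qed
qed

section \<open>Signed generating functions of admissible lists\<close>

lemma admissible_lists_fibre:
  assumes "1 \<le> N"
  shows "{\<alpha> \<in> admissible_lists k m. sum_list \<alpha> = N}
    = {\<alpha> \<in> compositions N. card (small_parts k \<alpha>) = m
         \<and> (\<forall>p\<in>small_parts k \<alpha>. required_condition k \<alpha> p)}"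
  using assms
  by (auto simp: admissible_lists_def admissible_def well_placed_def compositions_def)

lemma finite_fibres_admissible_lists: "finite_fibres (admissible_lists k m) sum_list"
  unfolding finite_fibres_def
proof
  fix n
  have "{\<alpha> \<in> admissible_lists k m. sum_list \<alpha> = n} \<subseteq> compositions n"
    by (auto simp: admissible_lists_def admissible_def compositions_def)
  then show "finite {\<alpha> \<in> admissible_lists k m. sum_list \<alpha> = n}"
    by (rule finite_subset) (rule finite_compositions)
qed

lemma singleton_notin_admissible_lists:
  "1 \<le> k \<Longrightarrow> [k - 1] \<notin> admissible_lists k m"
  by (auto simp: admissible_lists_def admissible_single)

lemma finite_fibres_extended_lists: "finite_fibres (extended_lists k m) sum_list"
proof -
  have sub: "{\<alpha> \<in> extended_lists k m. sum_list \<alpha> = n}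
      \<subseteq> insert [k - 1] {\<alpha> \<in> admissible_lists k m. sum_list \<alpha> = n}" for n
    by (auto simp: extended_lists_def split: if_splits)
  have "finite (insert [k - 1] {\<alpha> \<in> admissible_lists k m. sum_list \<alpha> = n})" for n
    by (intro finite.insertI finite_fibresD finite_fibres_admissible_lists)
  from finite_subset[OF sub this] show ?thesis
    unfolding finite_fibres_def by blast
qed

lemma Nil_notin_extended_lists: "[] \<notin> extended_lists k m"
  by (simp add: extended_lists_def admissible_lists_def)

lemma weighted_gf_extended_lists:
  assumes "1 \<le> k"
  shows "weighted_gf (extended_lists k m) sum_list sgn_length
    = weighted_gf (admissible_lists k m) sum_list sgn_length
      + (if m = 0 then fps_X ^ (k - 1) else 0)"
proof (cases "m = 0")
  case True
  have "weighted_gf (admissible_lists k m \<union> {[k - 1]}) sum_list sgn_length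
    = weighted_gf (admissible_lists k m) sum_list sgn_length
      + weighted_gf {[k - 1]} sum_list sgn_length"
    by (rule weighted_gf_Un)
      (use assms in \<open>auto simp: finite_fibres_admissible_lists finite_fibres_finite
          singleton_notin_admissible_lists simp del: One_nat_def\<close>)
  with True show ?thesis
    by (simp add: extended_lists_def weighted_gf_finite sgn_length_def)
qed (simp add: extended_lists_def)

text \<open>One more part reverses the sign.\<close>

lemma weighted_gf_Cons_lists:
  assumes "finite_fibres S sum_list"
  shows "weighted_gf ((\<lambda>(b, \<alpha>). b # \<alpha>) ` ({k..} \<times> S)) sum_list sgn_length
    = - (weighted_gf {k..} (\<lambda>b. b) (\<lambda>_. 1) * weighted_gf S sum_list sgn_length)"
proof -
  have "weighted_gf ((\<lambda>(b, \<alpha>). b # \<alpha>) ` ({k..} \<times> S)) sum_list sgn_length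
    = weighted_gf ({k..} \<times> S) (\<lambda>(b, \<alpha>). b + sum_list \<alpha>) 
        (\<lambda>p. - (case p of (b, \<alpha>) \<Rightarrow> 1 * sgn_length \<alpha>))"
    by (subst weighted_gf_image) (auto simp: inj_on_def sgn_length_def intro!: weighted_gf_cong)
  also have "\<dots> = - (weighted_gf {k..} (\<lambda>b. b) (\<lambda>_. 1) * weighted_gf S sum_list sgn_length)"
    using assms by (simp only: weighted_gf_uminus weighted_gf_times finite_fibres_id)
  finally show ?thesis .
qed

text \<open>Two more parts preserve the sign, and raising the head by one contributes
  \<open>fps_X\<close>. Nonemptiness lets head and tail recover the list, which gives
  injectivity.\<close>

lemma weighted_gf_small_lists:
  assumes "finite_fibres S sum_list" "[] \<notin> S"
  shows "weighted_gf ((\<lambda>(b, s, \<alpha>). b # s # Suc (hd \<alpha>) # tl \<alpha>) ` ({k..} \<times> {1..<k} \<times> S))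
      sum_list sgn_length
    = fps_X * (weighted_gf {k..} (\<lambda>b. b) (\<lambda>_. 1)
        * (weighted_gf {1..<k} (\<lambda>s. s) (\<lambda>_. 1) * weighted_gf S sum_list sgn_length))"
proof -
  have ne: "\<alpha> \<noteq> []" if "\<alpha> \<in> S" for \<alpha> using that assms(2) by auto
  have inj: "inj_on (\<lambda>(b, s, \<alpha>). b # s # Suc (hd \<alpha>) # tl \<alpha>) ({k..} \<times> {1..<k} \<times> S)"
    by (auto simp: inj_on_def dest!: ne intro: list.expand)
  have sum: "Suc (hd \<alpha> + sum_list (tl \<alpha>)) = sum_list \<alpha> + 1"
    and sgn: "sgn_length (b # s # Suc (hd \<alpha>) # tl \<alpha>) = sgn_length \<alpha>" if "\<alpha> \<in> S" for \<alpha> b s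
    using ne[OF that] by (cases \<alpha>; simp add: sgn_length_def)+
  have "weighted_gf ((\<lambda>(b, s, \<alpha>). b # s # Suc (hd \<alpha>) # tl \<alpha>) ` ({k..} \<times> {1..<k} \<times> S))
      sum_list sgn_length
    = weighted_gf ({k..} \<times> {1..<k} \<times> S)
        (\<lambda>p. (case p of (b, q) \<Rightarrow> b + (case q of (s, \<alpha>) \<Rightarrow> s + sum_list \<alpha>)) + 1)
        (\<lambda>(b, q). 1 * (case q of (s, \<alpha>) \<Rightarrow> 1 * sgn_length \<alpha>))"
    by (subst weighted_gf_image[OF inj], rule weighted_gf_cong)
      (auto simp: sum sgn)
  also have "\<dots> = fps_X * (weighted_gf {k..} (\<lambda>b. b) (\<lambda>_. 1)
        * (weighted_gf {1..<k} (\<lambda>s. s) (\<lambda>_. 1) * weighted_gf S sum_list sgn_length))"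
    using assms
    by (subst weighted_gf_shift)
      (simp add: weighted_gf_times finite_fibres_id finite_fibres_Times)
  finally show ?thesis .
qed

lemma weighted_gf_admissible_lists_0:
  assumes "1 \<le> k"
  shows "(1 - fps_X + fps_X ^ k) * weighted_gf (admissible_lists k 0) sum_list sgn_length = fps_X ^ k"
proof -
  let ?D = "weighted_gf {k..} (\<lambda>b. b) (\<lambda>_. 1) :: int fps"
  let ?F = "weighted_gf (admissible_lists k 0) sum_list sgn_length"
  let ?R1 = "(\<lambda>b. [b]) ` {k..}"
  let ?R2 = "(\<lambda>(b, \<alpha>). b # \<alpha>) ` ({k..} \<times> admissible_lists k 0)"
  \<comment> \<open>Both pieces inherit finite fibres as subsets of the whole set.\<close>
  have sub: "?R1 \<subseteq> admissible_lists k 0 \<and> ?R2 \<subseteq> admissible_lists k 0"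
    using equalityD2[OF admissible_lists_0[OF assms]] by (simp only: Un_subset_iff)
  have fin: "finite_fibres ?R1 sum_list" "finite_fibres ?R2 sum_list"
    by (rule finite_fibres_subset[OF finite_fibres_admissible_lists];
        rule sub[THEN conjunct1] sub[THEN conjunct2])+
  have "?R1 \<inter> ?R2 = {}"
    by (auto simp: admissible_lists_def)
  then have "?F = weighted_gf ?R1 sum_list sgn_length + weighted_gf ?R2 sum_list sgn_length"
    by (subst admissible_lists_0[OF assms]) (rule weighted_gf_Un[OF fin])
  also have "weighted_gf ?R1 sum_list sgn_length = ?D"
    by (subst weighted_gf_image) (simp_all add: inj_on_def sgn_length_def)
  also have "weighted_gf ?R2 sum_list sgn_length = - (?D * ?F)"
    by (rule weighted_gf_Cons_lists[OF finite_fibres_admissible_lists])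
  also have "?D + - (?D * ?F) = ?D - ?D * ?F" by simp
  finally have F: "?F = ?D - ?D * ?F" .
  show ?thesis
    by (simp only: solve_linear[OF F geometric_gf[of k]] geometric_gf)
qed

lemma weighted_gf_admissible_lists_Suc:
  assumes "1 \<le> k"
  shows "(1 - fps_X + fps_X ^ k) * weighted_gf (admissible_lists k (Suc m)) sum_list sgn_length
    = fps_X ^ k * weighted_gf {1..<k} (\<lambda>s. s) (\<lambda>_. 1) * fps_X
      * weighted_gf (extended_lists k m) sum_list sgn_length"
proof -
  let ?D = "weighted_gf {k..} (\<lambda>b. b) (\<lambda>_. 1) :: int fps"
  let ?E = "weighted_gf {1..<k} (\<lambda>s. s) (\<lambda>_. 1) :: int fps"
  let ?F = "weighted_gf (admissible_lists k (Suc m)) sum_list sgn_length"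
  let ?G = "weighted_gf (extended_lists k m) sum_list sgn_length"
  let ?R1 = "(\<lambda>(b, \<alpha>). b # \<alpha>) ` ({k..} \<times> admissible_lists k (Suc m))"
  let ?R2 = "(\<lambda>(b, s, \<alpha>). b # s # Suc (hd \<alpha>) # tl \<alpha>) ` ({k..} \<times> {1..<k} \<times> extended_lists k m)"
  have sub: "?R1 \<subseteq> admissible_lists k (Suc m) \<and> ?R2 \<subseteq> admissible_lists k (Suc m)"
    using equalityD2[OF admissible_lists_Suc[OF assms, of m]] by (simp only: Un_subset_iff)
  have fin: "finite_fibres ?R1 sum_list" "finite_fibres ?R2 sum_list"
    by (rule finite_fibres_subset[OF finite_fibres_admissible_lists];
        rule sub[THEN conjunct1] sub[THEN conjunct2])+
  \<comment> \<open>The second part is \<ge> \<open>k\<close> in \<open>?R1\<close> and <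
    \<open>k\<close> in \<open>?R2\<close>.\<close>
  have "?R1 \<inter> ?R2 = {}"
    by (auto simp: admissible_lists_def dest!: admissible_hd)
  then have "?F = weighted_gf ?R1 sum_list sgn_length + weighted_gf ?R2 sum_list sgn_length"
    by (subst admissible_lists_Suc[OF assms]) (rule weighted_gf_Un[OF fin])
  also have "weighted_gf ?R1 sum_list sgn_length = - (?D * ?F)"
    by (rule weighted_gf_Cons_lists[OF finite_fibres_admissible_lists])
  also have "weighted_gf ?R2 sum_list sgn_length = fps_X * (?D * (?E * ?G))"
    by (rule weighted_gf_small_lists[OF finite_fibres_extended_lists Nil_notin_extended_lists])
  also have "- (?D * ?F) + fps_X * (?D * (?E * ?G)) = fps_X * (?D * (?E * ?G)) - ?D * ?F"
    by simp
  finally have F: "?F = fps_X * (?D * (?E * ?G)) - ?D * ?F" .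
  have "(1 - fps_X + fps_X ^ k) * ?F = (1 - fps_X) * (fps_X * (?D * (?E * ?G)))"
    by (rule solve_linear[OF F geometric_gf[of k]])
  also have "\<dots> = ((1 - fps_X) * ?D) * ?E * fps_X * ?G"
    by (simp only: mult_ac)
  finally show ?thesis by (simp only: geometric_gf)
qed

text \<open>The total \<open>n + k - 1\<close> is positive, so leaving the empty list out of
  \<open>admissible_lists\<close> loses nothing.\<close>

lemma b_diff_eq_nth:
  assumes "1 \<le> k" "1 \<le> n"
  shows "b_diff k n m = weighted_gf (admissible_lists k m) sum_list sgn_length $ (n + k - 1)"
proof -
  let ?A = "admissible_compositions k n m"
  have fin: "finite ?A"
    by (rule finite_subset[OF _ finite_compositions[of "n + k - 1"]])
      (auto simp: admissible_compositions_def)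
  have "(\<Sum>\<alpha>\<in>?A. sgn_length \<alpha>)
      = (\<Sum>\<alpha>\<in>?A. if odd (length \<alpha>) then 1 else 0) - (\<Sum>\<alpha>\<in>?A. if even (length \<alpha>) then 1 else 0)"
    by (subst sum_subtractf[symmetric]) (auto simp: sgn_length_def intro!: sum.cong)
  also have "\<dots> = b_diff k n m"
    using fin by (simp add: b_diff_def c_odd_def c_even_def sum.If_cases Int_def)
  finally show ?thesis
    using assms admissible_lists_fibre[of "n + k - 1" k m]
    by (simp add: weighted_gf_def admissible_compositions_def)
qed


section \<open>The generating functions of the two sums\<close>

text \<open>The coefficient of x^j in (1 - s x)^(-i). It serves (1 + x^k)^(-i) with
  \<open>s = - 1\<close> and (1 - x)^(-m) with \<open>s = 1\<close>.\<close>

definition signed_choose :: "int \<Rightarrow> nat \<Rightarrow> nat \<Rightarrow> int" where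
  "signed_choose s i j = s ^ j * int_choose (int i + int j - 1) j"

lemma signed_choose_0: "signed_choose s i 0 = 1"
  by (simp add: signed_choose_def int_choose_def)

lemma signed_choose_Suc: "signed_choose s (Suc i) j = s ^ j * int ((i + j) choose j)"
  using int_choose_of_nat[of "i + j" j] by (simp add: signed_choose_def)

lemma signed_choose_0_Suc: "signed_choose s 0 (Suc j) = 0"
  using int_choose_of_nat[of j "Suc j"] by (simp add: signed_choose_def)

text \<open>Compares the coefficients of x^(j+1) in (1 - s x)^(-i) = (1 - s x) (1 - s
  x)^(-i-1).\<close>

lemma signed_choose_rec:
  "signed_choose s i (Suc j) = signed_choose s (Suc i) (Suc j) + - s * signed_choose s (Suc i) j"
proof (cases i)
  case 0
  then show ?thesis by (simp add: signed_choose_0_Suc signed_choose_Suc del: binomial_Suc_Suc)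
next
  case (Suc i')
  then show ?thesis by (simp add: signed_choose_Suc algebra_simps)
qed

text \<open>Prepares recurrences that step from \<open>j\<close> to \<open>Suc j\<close>: the pairs
  with \<open>j = 0\<close> are split off, and the others, shifted by one, carry the factor
  \<open>fps_X ^ k\<close>.\<close>

lemma weighted_gf_split_0:
  fixes v :: "'a \<Rightarrow> nat"
  assumes "1 \<le> k" "finite_fibres A v"
  shows "weighted_gf (A \<times> UNIV) (\<lambda>(i, j). v i + j * k) (\<lambda>(i, j). d i j)
    = weighted_gf A v (\<lambda>i. d i 0)
      + fps_X ^ k * weighted_gf (A \<times> UNIV) (\<lambda>(i, j). v i + j * k) (\<lambda>(i, j). d i (Suc j))"
proof -
  let ?w = "\<lambda>(i, j). v i + j * k" and ?d = "\<lambda>(i, j). d i j"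
  have fin: "finite_fibres B ?w" if "B \<subseteq> A \<times> UNIV" for B
    using that finite_fibres_Times[OF assms(2) finite_fibres_mult[OF assms(1)]]
    by (rule finite_fibres_subset[rotated])
  have split: "A \<times> UNIV = (\<lambda>i. (i, 0)) ` A \<union> (\<lambda>(i, j). (i, Suc j)) ` (A \<times> UNIV)"
    (is "_ = ?B \<union> ?C")
    using not0_implies_Suc by (fastforce simp: image_iff)
  have "weighted_gf (A \<times> UNIV) ?w ?d = weighted_gf ?B ?w ?d + weighted_gf ?C ?w ?d"
    by (subst split, rule weighted_gf_Un) (auto intro!: fin)
  also have "weighted_gf ?B ?w ?d = weighted_gf A v (\<lambda>i. d i 0)"
    by (subst weighted_gf_image) (auto simp: inj_on_def)
  also have "weighted_gf ?C ?w ?d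
      = weighted_gf (A \<times> UNIV) (\<lambda>p. ?w p + k) (\<lambda>(i, j). d i (Suc j))"
    by (subst weighted_gf_image) (auto simp: inj_on_def intro!: weighted_gf_cong)
  finally show ?thesis by (simp only: weighted_gf_shift)
qed

text \<open>The factor 1 - s x^k cancels one factor of (1 - s x^k)^(-f(i)-1) for every
  \<open>i\<close> at once. The function \<open>f\<close> allows an exponent that varies with the
  index as well as a constant one.\<close>

lemma weighted_gf_signed_choose_Suc:
  fixes v :: "'a \<Rightarrow> nat" and f :: "'a \<Rightarrow> nat"
  assumes "1 \<le> k" "finite_fibres A v"
  shows "(1 - fps_const s * fps_X ^ k)
      * weighted_gf (A \<times> UNIV) (\<lambda>(i, j). v i + j * k) (\<lambda>(i, j). c i * signed_choose s (Suc (f i)) j)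
    = weighted_gf (A \<times> UNIV) (\<lambda>(i, j). v i + j * k) (\<lambda>(i, j). c i * signed_choose s (f i) j)"
proof -
  let ?G = "\<lambda>d. weighted_gf (A \<times> UNIV) (\<lambda>(i, j). v i + j * k) (\<lambda>(i, j). d i j)"
  let ?d = "\<lambda>i j. c i * signed_choose s (Suc (f i)) j"
  have "?G (\<lambda>i j. c i * signed_choose s (f i) (Suc j))
      = weighted_gf (A \<times> UNIV) (\<lambda>(i, j). v i + j * k)
          (\<lambda>p. (case p of (i, j) \<Rightarrow> ?d i (Suc j)) + - s * (case p of (i, j) \<Rightarrow> ?d i j))"
    by (rule weighted_gf_cong) (auto simp: signed_choose_rec[of s "f _"] algebra_simps)
  also have "\<dots> = ?G (\<lambda>i j. ?d i (Suc j)) + fps_const (- s) * ?G ?d"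
    by (simp only: weighted_gf_add weighted_gf_cmult)
  finally have step: "?G (\<lambda>i j. c i * signed_choose s (f i) (Suc j))
      = ?G (\<lambda>i j. ?d i (Suc j)) + fps_const (- s) * ?G ?d" .
  have "?G (\<lambda>i j. c i * signed_choose s (f i) j)
      = (weighted_gf A v (\<lambda>i. ?d i 0) + fps_X ^ k * ?G (\<lambda>i j. ?d i (Suc j)))
        - fps_const s * fps_X ^ k * ?G ?d"
    by (subst weighted_gf_split_0[OF assms])
      (simp add: signed_choose_0 step algebra_simps flip: fps_const_neg)
  also have "\<dots> = ?G ?d - fps_const s * fps_X ^ k * ?G ?d"
    by (subst weighted_gf_split_0[OF assms, symmetric]) simp
  finally show ?thesis by (simp add: left_diff_distrib)
qed

text \<open>This is the sum of (i choose m) q^i over i \<ge> 0, where q = x / (1 + x^k). Its term at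
  \<open>i = 0\<close> is 1 for \<open>m = 0\<close> and 0 otherwise; it matches the extra list
  \<open>[k - 1]\<close>.\<close>

definition index_gf :: "nat \<Rightarrow> nat \<Rightarrow> int fps" where
  "index_gf k m = weighted_gf (UNIV \<times> UNIV) (\<lambda>(i, j). i + j * k)
     (\<lambda>(i, j). int (i choose m) * signed_choose (- 1) i j)"

text \<open>At \<open>i = 0\<close> only \<open>j = 0\<close> can contribute; elsewhere, replacing
  \<open>i\<close> by \<open>Suc i\<close> extracts \<open>fps_X\<close> and makes the exponent a
  successor.\<close>

lemma index_gf_split:
  assumes "1 \<le> k"
  shows "index_gf k m = (if m = 0 then 1 else 0)
    + fps_X * weighted_gf (UNIV \<times> UNIV) (\<lambda>(i, j). i + j * k)
        (\<lambda>(i, j). int (Suc i choose m) * signed_choose (- 1) (Suc i) j)"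
proof -
  let ?w = "\<lambda>(i, j). i + j * k"
    and ?c = "\<lambda>(i, j). int (i choose m) * signed_choose (- 1) i j"
  have fin: "finite_fibres B ?w" for B
    using finite_fibres_Times[OF finite_fibres_id[of UNIV] finite_fibres_mult[OF assms, of UNIV]]
    by (rule finite_fibres_subset) simp
  have split: "UNIV \<times> UNIV
      = {(0, 0)} \<union> ({0} \<times> range Suc \<union> (\<lambda>(i, j). (Suc i, j)) ` (UNIV \<times> UNIV))"
    (is "_ = ?A \<union> (?B \<union> ?C)")
    using not0_implies_Suc by (fastforce simp: image_iff)
  have "index_gf k m
      = weighted_gf ?A ?w ?c + (weighted_gf ?B ?w ?c + weighted_gf ?C ?w ?c)"
    unfolding index_gf_def
    by (subst split, subst weighted_gf_Un, (auto intro!: fin)[3], subst weighted_gf_Un)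
      (auto intro!: fin)
  also have "weighted_gf ?A ?w ?c = (if m = 0 then 1 else 0)"
    by (simp add: weighted_gf_finite signed_choose_0)
  also have "weighted_gf ?B ?w ?c = 0"
    by (rule weighted_gf_0) (auto simp: signed_choose_0_Suc)
  also have "weighted_gf ?C ?w ?c = weighted_gf (UNIV \<times> UNIV) (\<lambda>p. ?w p + 1)
        (\<lambda>(i, j). int (Suc i choose m) * signed_choose (- 1) (Suc i) j)"
    by (subst weighted_gf_image) (auto simp: inj_on_def intro!: weighted_gf_cong)
  finally show ?thesis by (simp only: weighted_gf_shift) simp
qed

text \<open>The geometric series 1 / (1 - q) = (1 + x^k) / (1 - x + x^k) for q = x / (1 +
  x^k).\<close>

lemma index_gf_0:
  assumes "1 \<le> k"
  shows "(1 - fps_X + fps_X ^ k) * index_gf k 0 = 1 + fps_X ^ k"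
  using weighted_gf_signed_choose_Suc[OF assms finite_fibres_id[of UNIV], of "- 1" "\<lambda>_. 1" "\<lambda>i. i"]
    index_gf_split[OF assms, of 0]
  by (simp add: index_gf_def algebra_simps flip: fps_const_neg)

text \<open>Since the sum of (i choose m) q^i is q^m / (1 - q)^(m+1), raising \<open>m\<close> by
  one multiplies it by q / (1 - q) = x / (1 - x + x^k). The derivation below obtains this from
  Pascal's rule.\<close>

lemma index_gf_Suc:
  assumes "1 \<le> k"
  shows "(1 - fps_X + fps_X ^ k) * index_gf k (Suc m) = fps_X * index_gf k m"
proof -
  let ?w = "\<lambda>(i, j). i + j * k"
  let ?K = "weighted_gf (UNIV \<times> UNIV) ?w
      (\<lambda>(i, j). int (Suc i choose Suc m) * signed_choose (- 1) (Suc i) j)"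
  have "(1 + fps_X ^ k) * ?K = weighted_gf (UNIV \<times> UNIV) ?w
      (\<lambda>(i, j). int (Suc i choose Suc m) * signed_choose (- 1) i j)"
    using weighted_gf_signed_choose_Suc[OF assms finite_fibres_id[of UNIV],
        of "- 1" "\<lambda>i. int (Suc i choose Suc m)" "\<lambda>i. i"]
    by (simp del: binomial_Suc_Suc flip: fps_const_neg)
  also have "\<dots> = weighted_gf (UNIV \<times> UNIV) ?w
      (\<lambda>p. (case p of (i, j) \<Rightarrow> int (i choose m) * signed_choose (- 1) i j)
         + (case p of (i, j) \<Rightarrow> int (i choose Suc m) * signed_choose (- 1) i j))"
    by (rule weighted_gf_cong) (auto simp: algebra_simps)
  also have "\<dots> = index_gf k m + index_gf k (Suc m)"
    by (simp only: weighted_gf_add index_gf_def)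
  finally have "fps_X * ((1 + fps_X ^ k) * ?K) = fps_X * (index_gf k m + index_gf k (Suc m))"
    by simp
  moreover have "index_gf k (Suc m) = fps_X * ?K"
    using index_gf_split[OF assms, of "Suc m"] by simp
  ultimately have "(1 + fps_X ^ k) * index_gf k (Suc m)
      = fps_X * (index_gf k m + index_gf k (Suc m))"
    by (simp only: mult.left_commute)
  then show ?thesis by (simp add: algebra_simps)
qed

text \<open>After multiplication by \<open>1 - fps_X + fps_X ^ k\<close> both sides obey the same
  recurrence in \<open>m\<close>. It closes up for \<open>extended_lists\<close>, which differs from
  \<open>admissible_lists\<close> only at \<open>m = 0\<close>.\<close>

lemma weighted_gf_extended_lists_eq:
  assumes "1 \<le> k"
  shows "weighted_gf (extended_lists k m) sum_list sgn_length
    = fps_X ^ (k - 1) * (fps_X ^ k * weighted_gf {1..<k} (\<lambda>s. s) (\<lambda>_. 1)) ^ m * index_gf k m"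
proof (induction m)
  have k: "fps_X ^ k = fps_X * fps_X ^ (k - 1)"
    using assms by (simp add: power_eq_if)
  let ?M = "1 - fps_X + fps_X ^ k :: int fps"
  \<comment> \<open>The constant term shows \<open>?M\<close> to be nonzero; integer power series
    form an integral domain, so \<open>?M\<close> can be cancelled.\<close>
  have "?M $ 0 = 1" using assms by simp
  then have M: "?M \<noteq> 0" by (metis fps_zero_nth zero_neq_one)
  {
    case 0
    have "?M * weighted_gf (extended_lists k 0) sum_list sgn_length
        = fps_X ^ k + ?M * fps_X ^ (k - 1)"
      by (simp only: weighted_gf_extended_lists[OF assms] weighted_gf_admissible_lists_0[OF assms]
          distrib_left if_True simp_thms)
    also have "\<dots> = fps_X ^ (k - 1) * (1 + fps_X ^ k)"
      by (simp add: k algebra_simps)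
    also have "\<dots> = ?M * (fps_X ^ (k - 1) * index_gf k 0)"
      by (simp only: index_gf_0[OF assms, symmetric] mult_ac)
    finally show ?case using M by simp
  next
    case (Suc m)
    have "?M * weighted_gf (extended_lists k (Suc m)) sum_list sgn_length
        = fps_X ^ (k - 1) * (fps_X ^ k * weighted_gf {1..<k} (\<lambda>s. s) (\<lambda>_. 1)) ^ Suc m
          * (fps_X * index_gf k m)"
      using assms
      by (simp add: weighted_gf_extended_lists[of k "Suc m"] weighted_gf_admissible_lists_Suc Suc
          mult_ac)
    also have "\<dots> = ?M * (fps_X ^ (k - 1)
        * (fps_X ^ k * weighted_gf {1..<k} (\<lambda>s. s) (\<lambda>_. 1)) ^ Suc m * index_gf k (Suc m))"
      by (simp only: index_gf_Suc[OF assms, symmetric] mult_ac)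
    finally show ?case using M by (metis mult_left_cancel)
  }
qed

section \<open>Powers of the truncated geometric series\<close>

definition truncated_gf :: "nat \<Rightarrow> int fps" where
  "truncated_gf r = weighted_gf {..<r} (\<lambda>t. t) (\<lambda>_. 1)"

lemma weighted_gf_small_parts:
  assumes "1 \<le> k"
  shows "weighted_gf {1..<k} (\<lambda>s. s) (\<lambda>_. 1) = fps_X * truncated_gf (k - 1)"
proof -
  have "{1..<k} = Suc ` {..<k - 1}"
    using assms by (simp add: lessThan_atLeast0 image_Suc_atLeastLessThan)
  then have "weighted_gf {1..<k} (\<lambda>s. s) (\<lambda>_. 1 :: int)
      = weighted_gf {..<k - 1} (\<lambda>t. t + 1) (\<lambda>_. 1)"
    by (simp add: weighted_gf_image)
  then show ?thesis by (simp only: weighted_gf_shift truncated_gf_def) simp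
qed

lemma b_diff_eq:
  assumes "1 \<le> k" "1 \<le> n"
  shows "b_diff k n m = (fps_X ^ ((k + 1) * m) * (truncated_gf (k - 1) ^ m * index_gf k m)) $ n"
proof -
  \<comment> \<open>For \<open>n \<ge> 1\<close> the exponent exceeds \<open>k - 1\<close>, so the
    extra term \<open>fps_X ^ (k - 1)\<close> does not reach this coefficient.\<close>
  have "b_diff k n m = weighted_gf (extended_lists k m) sum_list sgn_length $ (n + k - 1)"
    using assms by (simp add: b_diff_eq_nth weighted_gf_extended_lists)
  also have "\<dots> = (fps_X ^ (k - 1)
      * ((fps_X ^ k * (fps_X * truncated_gf (k - 1))) ^ m * index_gf k m)) $ (n + k - 1)"
    using assms by (simp only: weighted_gf_extended_lists_eq weighted_gf_small_parts mult.assoc)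
  also have "\<dots> = ((fps_X ^ k * (fps_X * truncated_gf (k - 1))) ^ m * index_gf k m) $ n"
    using assms by (subst fps_X_power_mult_nth) simp
  also have "(fps_X ^ k * (fps_X * truncated_gf (k - 1))) ^ m
      = fps_X ^ ((k + 1) * m) * truncated_gf (k - 1) ^ m"
    by (simp only: mult.assoc[symmetric] power_mult_distrib power_mult power_Suc2[symmetric]) simp
  finally show ?thesis by (simp only: mult.assoc)
qed

lemma truncated_gf_power:
  "truncated_gf r ^ m = weighted_gf {xs. length xs = m \<and> set xs \<subseteq> {..<r}} sum_list (\<lambda>_. 1)"
proof (induction m)
  case 0
  have "{xs. length xs = 0 \<and> set xs \<subseteq> {..<r}} = {[]}" by auto
  then show ?case by (simp add: weighted_gf_finite)
next
  case (Suc m)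
  let ?L = "\<lambda>m. {xs. length xs = m \<and> set xs \<subseteq> {..<r}}"
  have "finite (?L m)" using finite_lists_length_eq[of "{..<r}" m] by (simp add: conj_commute)
  then have "truncated_gf r ^ Suc m
      = weighted_gf ({..<r} \<times> ?L m) (\<lambda>(x, xs). x + sum_list xs) (\<lambda>(x, xs). 1 * 1)"
    unfolding power_Suc Suc.IH
    unfolding truncated_gf_def
    by (intro weighted_gf_times finite_fibres_finite) simp_all
  also have "\<dots> = weighted_gf ((\<lambda>(x, xs). x # xs) ` ({..<r} \<times> ?L m)) sum_list (\<lambda>_. 1)"
    by (subst weighted_gf_image) (auto simp: inj_on_def intro!: weighted_gf_cong)
  also have "(\<lambda>(x, xs). x # xs) ` ({..<r} \<times> ?L m) = ?L (Suc m)"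
    by (auto simp: length_Suc_conv image_iff)
  finally show ?case .
qed

lemma monomial_sym_ones_card:
  "monomial_sym_ones lam = card (permutations_of_multiset (mset lam))"
  by (simp add: monomial_sym_ones_def monomial_sym_def)

text \<open>The words of length \<open>m\<close> with entries < \<open>k - 1\<close> are grouped by
  their decreasing rearrangement \<open>lam\<close>; each class has
  \<open>monomial_sym_ones lam\<close> members. For \<open>k = 1\<close> the bounds admit only the
  empty list on both sides.\<close>

lemma truncated_gf_power_partitions:
  assumes "1 \<le> k"
  shows "truncated_gf (k - 1) ^ m
    = weighted_gf (box_partitions (int k - 2) m) sum_list (\<lambda>lam. int (monomial_sym_ones lam))"
proof (rule fps_ext)
  fix n
  let ?B = "{lam \<in> box_partitions (int k - 2) m. sum_list lam = n}"
  have "{xs. (length xs = m \<and> set xs \<subseteq> {..<k - 1}) \<and> sum_list xs = n}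
      = (\<Union>lam\<in>?B. permutations_of_multiset (mset lam))" (is "?L = ?R")
  proof (rule equalityI; rule subsetI)
    fix xs assume xs: "xs \<in> ?L"
    then have "rev (sort xs) \<in> ?B"
      by (auto simp: box_partitions_def sum_list.rev sorted_wrt_rev simp flip: sum_mset_sum_list)
    moreover have "xs \<in> permutations_of_multiset (mset (rev (sort xs)))"
      by (simp add: permutations_of_multiset_def)
    ultimately show "xs \<in> ?R" by blast
  next
    fix xs assume "xs \<in> ?R"
    then obtain lam where lam: "lam \<in> ?B" and eq: "mset xs = mset lam"
      by (auto simp: permutations_of_multiset_def)
    have "length xs = length lam" "set xs = set lam" "sum_list xs = sum_list lam"
      using eq by (metis size_mset, metis set_mset_mset, metis sum_mset_sum_list)
    with lam show "xs \<in> ?L" by (auto simp: box_partitions_def)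
  qed
  moreover have "card ?R = (\<Sum>lam\<in>?B. card (permutations_of_multiset (mset lam)))"
  proof (rule card_UN_disjoint)
    show "finite ?B" using finite_box_partitions by (rule rev_finite_subset) auto
    show "\<forall>lam\<in>?B. \<forall>lam'\<in>?B. lam \<noteq> lam' \<longrightarrow>
        permutations_of_multiset (mset lam) \<inter> permutations_of_multiset (mset lam') = {}"
    proof (intro ballI impI)
      fix lam lam' assume "lam \<in> ?B" "lam' \<in> ?B" "lam \<noteq> lam'"
      \<comment> \<open>A sorted list is determined by its multiset, so distinct partitions have
        disjoint classes.\<close>
      then have "sorted (rev lam)" "sorted (rev lam')" "rev lam \<noteq> rev lam'"
        by (auto simp: box_partitions_def sorted_wrt_rev)
      then have "mset lam \<noteq> mset lam'"
        by (metis mset_rev properties_for_sort)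
      then show "permutations_of_multiset (mset lam) \<inter> permutations_of_multiset (mset lam') = {}"
        by (auto simp: permutations_of_multiset_def)
    qed
  qed simp
  ultimately show "truncated_gf (k - 1) ^ m $ n
      = weighted_gf (box_partitions (int k - 2) m) sum_list (\<lambda>lam. int (monomial_sym_ones lam)) $ n"
    by (simp add: truncated_gf_power weighted_gf_def monomial_sym_ones_card)
qed

definition negative_binomial_gf :: "nat \<Rightarrow> int fps" where
  "negative_binomial_gf m = weighted_gf UNIV (\<lambda>h. h) (\<lambda>h. int_choose (int m + int h - 1) h)"

lemma negative_binomial_gf_inverse: "(1 - fps_X) ^ m * negative_binomial_gf m = 1"
proof (induction m)
  case 0
  have "negative_binomial_gf 0 = weighted_gf ({0} \<union> range Suc) (\<lambda>h. h) (\<lambda>h. signed_choose 1 0 h)"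
    unfolding negative_binomial_gf_def signed_choose_def
    by (rule arg_cong2[where f = "\<lambda>A. weighted_gf A (\<lambda>h. h)"])
      (use not0_implies_Suc in blast, simp)
  also have "\<dots> = 1 + weighted_gf (range Suc) (\<lambda>h. h) (\<lambda>h. signed_choose 1 0 h)"
    by (subst weighted_gf_Un) (auto simp: finite_fibres_id weighted_gf_finite signed_choose_0)
  also have "weighted_gf (range Suc) (\<lambda>h. h) (\<lambda>h. signed_choose 1 0 h) = 0"
    by (rule weighted_gf_0) (auto simp: signed_choose_0_Suc)
  finally show ?case by simp
next
  case (Suc m)
  \<comment> \<open>A one-point index set of weight 0, together with \<open>k = 1\<close>, reduces
    the two-index recurrence \<open>weighted_gf_signed_choose_Suc\<close> to a single
    series.\<close>
  have "weighted_gf ({()} \<times> UNIV) (\<lambda>(_, h). 0 + h * 1) (\<lambda>(_, h). 1 * signed_choose 1 m h)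
      = negative_binomial_gf m" for m
  proof -
    have "{()} \<times> UNIV = range (Pair () :: nat \<Rightarrow> _)" by auto
    then show ?thesis
      by (simp add: negative_binomial_gf_def signed_choose_def weighted_gf_image inj_on_def)
  qed
  then have rec: "(1 - fps_X) * negative_binomial_gf (Suc m) = negative_binomial_gf m"
    using weighted_gf_signed_choose_Suc[of 1 "{()}" "\<lambda>_. 0" 1 "\<lambda>_. 1" "\<lambda>_. m"]
    by (simp add: finite_fibres_finite)
  show ?case
    by (simp only: power_Suc2 mult.assoc rec Suc)
qed

lemma truncated_gf_geometric: "(1 - fps_X) * truncated_gf r = 1 - fps_X ^ r"
  by (simp add: truncated_gf_def weighted_gf_finite one_diff_power_eq)

text \<open>The power is (1 - x^r)^m (1 - x)^(-m), with the first factor expanded by the binomial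
  theorem. The finite range of \<open>l\<close> keeps the fibres finite even for
  \<open>r = 0\<close>.\<close>

lemma truncated_gf_power_binomials:
  "truncated_gf r ^ m
    = weighted_gf {..m} (\<lambda>l. l * r) (\<lambda>l. (- 1) ^ l * int (m choose l)) * negative_binomial_gf m"
proof -
  have "(1 - fps_X ^ r :: int fps) ^ m
      = weighted_gf {..m} (\<lambda>l. l * r) (\<lambda>l. (- 1) ^ l * int (m choose l))"
    using binomial_ring[of "- (fps_X ^ r) :: int fps" 1 m]
    by (simp add: weighted_gf_finite power_minus[of "fps_X ^ r"] power_mult[symmetric] mult_ac
        fps_of_nat fps_of_int flip: fps_const_mult fps_const_power fps_const_neg)
  moreover have "truncated_gf r ^ m
      = ((1 - fps_X) * truncated_gf r) ^ m * negative_binomial_gf m"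
    using negative_binomial_gf_inverse[of m] by (simp add: power_mult_distrib mult_ac)
  ultimately show ?thesis by (simp add: truncated_gf_geometric)
qed

section \<open>Extraction of the coefficient of x^n from both expansions\<close>

theorem theorem4p3:
  fixes k m n :: nat
  assumes "1 \<le> k" and "1 \<le> n"
  shows
    "b_diff k n m =
       (\<Sum>(lam, i, j) \<in> {(lam, i, j). lam \<in> box_partitions (int k - 2) m \<and>
                              i + (k + 1) * m + j * k + sum_list lam = n}.
          (- 1) ^ j * int (i choose m) * int_choose (int i + int j - 1) j
            * int (monomial_sym_ones lam))
     \<and>
     b_diff k n m =
       (\<Sum>(i, j, l, h).
          if i + (k + 1) * m + j * k + l * (k - 1) + h = n
          then (- 1) ^ (l + j) * int (i choose m) * int_choose (int i + int j - 1) j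
                 * int (m choose l) * int_choose (int m + int h - 1) h
          else 0)"
proof
  have fin: "finite_fibres (UNIV \<times> UNIV) (\<lambda>(i, j). i + j * k)"
    by (intro finite_fibres_Times finite_fibres_id finite_fibres_mult assms)
  let ?B = "box_partitions (int k - 2) m"
  \<comment> \<open>The factor \<open>fps_X ^ ((k + 1) * m)\<close> becomes the constant shift of
    the weight.\<close>
  have "b_diff k n m = weighted_gf (?B \<times> UNIV \<times> UNIV)
      (\<lambda>p. (case p of (lam, q) \<Rightarrow> sum_list lam + (case q of (i, j) \<Rightarrow> i + j * k)) + (k + 1) * m)
      (\<lambda>(lam, q). int (monomial_sym_ones lam)
         * (case q of (i, j) \<Rightarrow> int (i choose m) * signed_choose (- 1) i j)) $ n"
    unfolding b_diff_eq[OF assms] truncated_gf_power_partitions[OF assms(1)] index_gf_def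
    by (simp only: weighted_gf_shift
        weighted_gf_times[OF finite_fibres_finite[OF finite_box_partitions] fin])
  also have "\<dots> = (\<Sum>(lam, i, j) \<in> {(lam, i, j). lam \<in> ?B \<and>
                              i + (k + 1) * m + j * k + sum_list lam = n}.
          (- 1) ^ j * int (i choose m) * int_choose (int i + int j - 1) j
            * int (monomial_sym_ones lam))"
    unfolding weighted_gf_def fps_nth_Abs_fps
    by (rule sum.cong) (auto simp: signed_choose_def)
  finally show "b_diff k n m = \<dots>" .

  let ?W = "\<lambda>p. (case p of (q, q') \<Rightarrow> (case q of (l, h) \<Rightarrow> l * (k - 1) + h)
      + (case q' of (i, j) \<Rightarrow> i + j * k)) + (k + 1) * m"
  let ?c = "\<lambda>(q, q').
      (case q of (l, h) \<Rightarrow> (- 1) ^ l * int (m choose l) * int_choose (int m + int h - 1) h)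
      * (case q' of (i, j) \<Rightarrow> int (i choose m) * signed_choose (- 1) i j)"
  let ?S = "{p \<in> ({..m} \<times> UNIV) \<times> UNIV \<times> UNIV. ?W p = n}"
  let ?f = "\<lambda>((l, h), (i, j)). (i, j, l, h)"
  let ?g = "\<lambda>(i, j, l, h). if i + (k + 1) * m + j * k + l * (k - 1) + h = n
          then (- 1) ^ (l + j) * int (i choose m) * int_choose (int i + int j - 1) j
                 * int (m choose l) * int_choose (int m + int h - 1) h
          else 0"
  have fin': "finite_fibres ({..m} \<times> UNIV) (\<lambda>(l, h). l * (k - 1) + h)"
    by (intro finite_fibres_Times finite_fibres_id finite_fibres_finite) simp
  \<comment> \<open>Every element of \<open>?S\<close> has unshifted weight
    \<open>n - (k + 1) * m\<close>, so \<open>?S\<close> lies in one finite fibre.\<close>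
  have "finite ?S"
    by (rule finite_subset[OF _ finite_fibresD[OF finite_fibres_Times[OF fin' fin],
            of "n - (k + 1) * m"]]) auto
  have "b_diff k n m = weighted_gf (({..m} \<times> UNIV) \<times> UNIV \<times> UNIV) ?W ?c $ n"
    unfolding b_diff_eq[OF assms] truncated_gf_power_binomials negative_binomial_gf_def index_gf_def
    by (simp only: weighted_gf_shift weighted_gf_times[OF fin' fin]
        weighted_gf_times[OF finite_fibres_finite[OF finite_atMost] finite_fibres_id])
  also have "\<dots> = sum ?c ?S" by (simp only: weighted_gf_def fps_nth_Abs_fps)
  \<comment> \<open>\<open>?f\<close> only rearranges the indices into the order of the stated
    sum.\<close>
  also have "\<dots> = sum ?g (?f ` ?S)"
    by (subst sum.reindex)
      (auto simp: inj_on_def signed_choose_def power_add intro!: sum.cong)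
  also have "\<dots> = Sum_any ?g"
  proof (rule Sum_any.expand_superset[symmetric])
    show "finite (?f ` ?S)" using \<open>finite ?S\<close> by (rule finite_imageI)
    \<comment> \<open>A nonzero term has \<open>l \<le> m\<close>, since otherwise the factor
      \<open>m choose l\<close> vanishes.\<close>
    show "{a. ?g a \<noteq> 0} \<subseteq> ?f ` ?S"
    proof
      fix a assume a: "a \<in> {a. ?g a \<noteq> 0}"
      obtain i j l h where "a = (i, j, l, h)" by (cases a)
      with a show "a \<in> ?f ` ?S"
        by (intro image_eqI[where x = "((l, h), (i, j))"])
          (auto split: if_splits intro: leI)
    qed
  qed
  finally show "b_diff k n m = Sum_any ?g" .
qed

end
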